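(* Let $A$ be a compact metric space without isolated points and $f:A\to A$ a continuous map such that the semicascade $(A,f)$ is minimal. Let $\mu$ be a Borel probability measure on $A$ with full support such that the system $(A,\mu,f)$ is ergodic. Let $h:A\to\mathbb{C}$ be a continuous function with $\gamma=\int_A\log|h|\,d\mu$ finite. Let $X$ be an infinite dimensional separable complex Banach space, $T$ a bounded linear operator on $X$, and let $P:A\times X\to A\times X$ be the skew product $P(a,x)=(f(a),h(a)Tx)$. Suppose there exist two dense subsets $D_1,D_2$ of $X$, an increasing sequence $(n_k)$ of positive integers and a sequence of mappings $S_{n_k}:D_2\to X$ such that (i) $\limsup_k\|T^{n_k}x\|^{1/n_k}<e^{-\gamma}$ for every $x\in D_1$; (ii) $\limsup_k\|S_{n_k}y\|^{1/n_k}<e^{\gamma}$ for every $y\in D_2$; (iii) $\|T^{n_k}S_{n_k}y-y\|\to0$ as $k\to\infty$ for every $y\in D_2$. Then $(A\times X,P)$ is topologically transitive. Moreover, the set $\{a\in A: (a,x)\text{ is a transitive point of }(A\times X,P)\text{ for some }x\in X\}$ has $\mu$-measure $1$.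
   Context: A semicascade $(Y,S)$ is a space $Y$ with a continuous self-map $S$. It is minimal if for every $y\in Y$ the orbit $\{S^ny:n\ge0\}$ is dense in $Y$. It is topologically transitive if for all nonempty open $U,V\subset Y$ there is an integer $n\ge1$ with $S^n(U)\cap V\ne\emptyset$. A transitive point of $(Y,S)$ is a point whose orbit $\{S^ny:n\ge 0\}$ is dense in $Y$. $(A,\mu,f)$ ergodic means that $f$ preserves $\mu$ and every Borel set $\Gamma$ with $f^{-1}(\Gamma)=\Gamma$ has measure $0$ or $1$. $\mu$ has full support if $\mu(U)>0$ for every nonempty open $U$. The maps $S_{n_k}$ are arbitrary maps (not assumed linear or continuous). *)

theory Defs
  imports "HOL-Probability.Probability_Measure"
begin

text \<open>Complex normed spaces: a real normed space whose real scalar multiplication is the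
  restriction of a complex one. Complex Banach spaces have sort
  \<open>{complex_normed_vector, banach}\<close>.\<close>

class complex_normed_vector = real_normed_vector +
  fixes scaleC :: "complex \<Rightarrow> 'a \<Rightarrow> 'a"  (infixr \<open>*\<^sub>C\<close> 75)
  assumes scaleC_add_right: "c *\<^sub>C (x + y) = c *\<^sub>C x + c *\<^sub>C y"
    and scaleC_add_left: "(c + d) *\<^sub>C x = c *\<^sub>C x + d *\<^sub>C x"
    and scaleC_scaleC: "c *\<^sub>C (d *\<^sub>C x) = (c * d) *\<^sub>C x"
    and scaleC_one: "1 *\<^sub>C x = x"
    and scaleR_scaleC: "r *\<^sub>R x = complex_of_real r *\<^sub>C x"
    and norm_scaleC: "norm (c *\<^sub>C x) = cmod c * norm x"

global_interpretation complex_vector: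
  vector_space "scaleC :: complex \<Rightarrow> 'a \<Rightarrow> 'a::complex_normed_vector"
  defines cspan = complex_vector.span
  by standard (simp_all add: scaleC_add_right scaleC_add_left scaleC_scaleC scaleC_one)

definition infinite_dimensional :: "'a::complex_normed_vector itself \<Rightarrow> bool" where
  "infinite_dimensional _ \<longleftrightarrow> \<not> (\<exists>B::'a set. finite B \<and> cspan B = UNIV)"

definition bounded_clinear ::
  "('a::complex_normed_vector \<Rightarrow> 'b::complex_normed_vector) \<Rightarrow> bool" where
  "bounded_clinear T \<longleftrightarrow>
     Vector_Spaces.linear scaleC scaleC T \<and> (\<exists>K. \<forall>x. norm (T x) \<le> K * norm x)"

definition orbit :: "('y \<Rightarrow> 'y) \<Rightarrow> 'y \<Rightarrow> 'y set" where
  "orbit S y = {(S ^^ n) y | n. True}"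

definition transitive_point :: "('y::topological_space \<Rightarrow> 'y) \<Rightarrow> 'y \<Rightarrow> bool" where
  "transitive_point S y \<longleftrightarrow> closure (orbit S y) = UNIV"

definition minimal_system :: "('y::topological_space \<Rightarrow> 'y) \<Rightarrow> bool" where
  "minimal_system S \<longleftrightarrow> (\<forall>y. closure (orbit S y) = UNIV)"

definition topologically_transitive :: "('y::topological_space \<Rightarrow> 'y) \<Rightarrow> bool" where
  "topologically_transitive S \<longleftrightarrow>
     (\<forall>U V. open U \<and> U \<noteq> {} \<and> open V \<and> V \<noteq> {} \<longrightarrow> (\<exists>n\<ge>1. (S ^^ n) ` U \<inter> V \<noteq> {}))"

definition ergodic_system :: "'a measure \<Rightarrow> ('a \<Rightarrow> 'a) \<Rightarrow> bool" where
  "ergodic_system M f \<longleftrightarrow>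
     f \<in> measurable M M \<and> distr M M f = M \<and>
     (\<forall>\<Gamma>\<in>sets M. f -` \<Gamma> \<inter> space M = \<Gamma> \<longrightarrow> measure M \<Gamma> = 0 \<or> measure M \<Gamma> = 1)"

definition full_support :: "'a::topological_space measure \<Rightarrow> bool" where
  "full_support M \<longleftrightarrow> (\<forall>U. open U \<and> U \<noteq> {} \<longrightarrow> emeasure M U > 0)"

text \<open>The function \<open>h\<close> may have zeros, so \<open>log \<bar>h\<bar>\<close> takes the value \<open>-\<infinity>\<close> there.
  (The library's real logarithm satisfies \<open>ln 0 = 0\<close>, and would wrongly make the integral
  finite for a function that vanishes on a set of positive measure.)\<close>

definition elog :: "real \<Rightarrow> ereal" where
  "elog r = (if r = 0 then - \<infinity> else ereal (ln r))"

text \<open>Lebesgue integral of an extended real function, as the difference of the integrals of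
  the positive and negative parts (\<open>e2ennreal\<close> truncates negative values to \<open>0\<close>).
  In \<open>ereal\<close> one has \<open>\<infinity> - \<infinity> = \<infinity>\<close>, so a finite value means that both parts have a finite
  integral.\<close>

definition ext_integral :: "'a measure \<Rightarrow> ('a \<Rightarrow> ereal) \<Rightarrow> ereal" where
  "ext_integral M u =
     enn2ereal (\<integral>\<^sup>+ a. e2ennreal (u a) \<partial>M) - enn2ereal (\<integral>\<^sup>+ a. e2ennreal (- u a) \<partial>M)"

definition skew_product ::
  "('a \<Rightarrow> 'a) \<Rightarrow> ('a \<Rightarrow> complex) \<Rightarrow> ('x \<Rightarrow> 'x) \<Rightarrow> 'a \<times> 'x \<Rightarrow> 'a \<times> 'x::complex_normed_vector"
  where "skew_product f h T = (\<lambda>(a, x). (f a, h a *\<^sub>C T x))"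

end

theory Submission
  imports Defs
begin

text \<open>By the ergodic theorem, at almost every \<open>a\<close> the products
  \<open>h\<^sub>m(a) = h(a) h(f a) \<cdots> h(f\<^bsup>m-1\<^esup> a)\<close> grow like \<open>exp (m \<gamma>)\<close> up to a subexponential factor.
  Fix such an \<open>a\<close>, nonempty open sets \<open>V\<^sub>1\<close>, \<open>V\<^sub>2\<close> and a point \<open>x \<in> D1\<close>. The visits of the orbit
  of \<open>a\<close> to \<open>V\<^sub>1\<close> need not happen at the times \<open>n k\<close>, but by minimality and compactness finitely
  many preimages of \<open>V\<^sub>1\<close> under iterates of \<open>f\<close> cover the space, so some fixed delay \<open>j\<close> has
  \<open>f\<^bsup>j + n k\<^esup> a \<in> V\<^sub>1\<close> for infinitely many \<open>k\<close>. As \<open>T\<close> has dense range, there is \<open>y \<in> D2\<close> with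
  \<open>T\<^bsup>j\<^esup> y \<in> V\<^sub>2\<close>. The points \<open>x + S (n k) y / h\<^bsub>j + n k\<^esub>(a)\<close> tend to \<open>x\<close>, and the fibre
  components of their images at time \<open>j + n k\<close> tend to \<open>T\<^bsup>j\<^esup> y\<close>. This gives transitivity, and
  Baire's theorem in the single fibre over \<open>a\<close> gives a transitive point.\<close>

section \<open>Birkhoff sums and the pointwise ergodic theorem\<close>

definition birkhoff_sum :: "('a \<Rightarrow> 'a) \<Rightarrow> ('a \<Rightarrow> real) \<Rightarrow> nat \<Rightarrow> 'a \<Rightarrow> real" where
  "birkhoff_sum f u n a = (\<Sum>i<n. u ((f ^^ i) a))"

lemma birkhoff_sum_Suc: "birkhoff_sum f u (Suc n) a = u a + birkhoff_sum f u n (f a)"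
  unfolding birkhoff_sum_def by (subst sum.lessThan_Suc_shift) (simp add: funpow_swap1)

text \<open>The largest of the Birkhoff sums of lengths 0 to \<open>n\<close>, in recursive form.
  The empty sum takes part, which is why the value is never negative.\<close>

primrec birkhoff_max :: "('a \<Rightarrow> 'a) \<Rightarrow> ('a \<Rightarrow> real) \<Rightarrow> nat \<Rightarrow> 'a \<Rightarrow> real" where
  "birkhoff_max f u 0 a = 0"
| "birkhoff_max f u (Suc n) a = max 0 (u a + birkhoff_max f u n (f a))"

lemma birkhoff_max_nonneg: "0 \<le> birkhoff_max f u n a"
  by (cases n) auto

lemma birkhoff_max_le_Suc: "birkhoff_max f u n a \<le> birkhoff_max f u (Suc n) a"
proof (induction n arbitrary: a)
  case (Suc n)
  have "u a + birkhoff_max f u n (f a) \<le> u a + birkhoff_max f u (Suc n) (f a)"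
    by (intro add_left_mono Suc.IH)
  then show ?case
    unfolding birkhoff_max.simps(2)[of f u n a] birkhoff_max.simps(2)[of f u "Suc n" a]
    by (intro max.mono order_refl)
qed simp

lemma birkhoff_max_mono: "m \<le> n \<Longrightarrow> birkhoff_max f u m a \<le> birkhoff_max f u n a"
  by (rule lift_Suc_mono_le[of "\<lambda>n. birkhoff_max f u n a"]) (rule birkhoff_max_le_Suc)

lemma birkhoff_sum_le_max: "birkhoff_sum f u n a \<le> birkhoff_max f u n a"
proof (induction n arbitrary: a)
  case (Suc n)
  have "u a + birkhoff_sum f u n (f a) \<le> u a + birkhoff_max f u n (f a)"
    by (intro add_left_mono Suc.IH)
  then show ?case
    by (simp add: birkhoff_sum_Suc le_max_iff_disj)
qed (simp add: birkhoff_sum_def)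

lemma borel_measurable_birkhoff_sum:
  assumes f: "f \<in> measurable M M" and u: "u \<in> borel_measurable M"
  shows "birkhoff_sum f u n \<in> borel_measurable M"
proof -
  have "(\<lambda>a. u ((f ^^ i) a)) \<in> borel_measurable M" for i
    using measurable_compose[OF measurable_compose_n[OF f, of i] u] .
  then show ?thesis
    unfolding birkhoff_sum_def[abs_def] by measurable
qed

lemma integrable_comp_measure_preserving:
  fixes u :: "'a \<Rightarrow> real"
  assumes "f \<in> measurable M M" "distr M M f = M" "integrable M u"
  shows "integrable M (\<lambda>a. u (f a))" "(\<integral>a. u (f a) \<partial>M) = (\<integral>a. u a \<partial>M)"
proof -
  show "integrable M (\<lambda>a. u (f a))"
    using assms integrable_distr by metis
  show "(\<integral>a. u (f a) \<partial>M) = (\<integral>a. u a \<partial>M)"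
    using integral_distr[OF assms(1), of u] assms by (simp add: borel_measurable_integrable)
qed

lemma integrable_birkhoff_max:
  assumes "f \<in> measurable M M" "distr M M f = M" "integrable M u"
  shows "integrable M (birkhoff_max f u n)"
proof (induction n)
  case (Suc n)
  have "integrable M (\<lambda>a. birkhoff_max f u n (f a))"
    using integrable_comp_measure_preserving[OF assms(1,2) Suc.IH] by simp
  then show ?case
    using assms(3) by simp
qed simp

text \<open>Garsia's argument: where the maximum is positive, its recursion gives
  \<open>?m a - ?m (f a) \<le> u a\<close>; elsewhere \<open>?m a = 0\<close> and the difference is
  at most 0. The difference integrates to 0 because \<open>f\<close> preserves the measure.\<close>

lemma maximal_ergodic_inequality:
  assumes f: "f \<in> measurable M M" "distr M M f = M" and u: "integrable M u"
  shows "0 \<le> (\<integral>a. indicator {a \<in> space M. 0 < birkhoff_max f u (Suc n) a} a * u a \<partial>M)"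
proof -
  let ?m = "birkhoff_max f u (Suc n)"
  let ?E = "{a \<in> space M. 0 < ?m a}"
  have m: "integrable M ?m"
    by (rule integrable_birkhoff_max[OF f u])
  note mf = integrable_comp_measure_preserving[OF f m]
  have [measurable]: "?m \<in> borel_measurable M"
    using m by (rule borel_measurable_integrable)
  have E: "?E \<in> sets M"
    by measurable
  have "0 = (\<integral>a. ?m a - ?m (f a) \<partial>M)"
    using m mf by (simp del: birkhoff_max.simps)
  also have "\<dots> \<le> (\<integral>a. indicator ?E a * u a \<partial>M)"
  proof (rule integral_mono)
    show "integrable M (\<lambda>a. ?m a - ?m (f a))"
      using m mf by (simp del: birkhoff_max.simps)
    show "integrable M (\<lambda>a. indicator ?E a * u a)"
      using integrable_mult_indicator[OF E u] by simp
    fix a assume a: "a \<in> space M"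
    show "?m a - ?m (f a) \<le> indicator ?E a * u a"
    proof (cases "0 < ?m a")
      case True
      then have "?m a = u a + birkhoff_max f u n (f a)"
        by (auto simp: max_def split: if_splits)
      moreover have "birkhoff_max f u n (f a) \<le> ?m (f a)"
        by (rule birkhoff_max_le_Suc)
      ultimately show ?thesis
        using True a by (simp del: birkhoff_max.simps)
    next
      case False
      then have "?m a = 0"
        using birkhoff_max_nonneg[of f u "Suc n" a] by linarith
      then show ?thesis
        using birkhoff_max_nonneg[of f u "Suc n" "f a"] False by (simp del: birkhoff_max.simps)
    qed
  qed
  finally show ?thesis .
qed

text \<open>The set where the Birkhoff sums are unbounded above is exactly invariant; if it had full
  measure, the sets in the maximal inequality would exhaust the space, and the integral of \<open>u\<close>
  would be nonnegative. The upper and lower bounds of the ergodic theorem follow by shifting \<open>u\<close>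
  by a constant and changing its sign.\<close>

lemma AE_birkhoff_sum_bounded_above:
  assumes "prob_space M" and erg: "ergodic_system M f" and u: "integrable M u"
    and neg: "(\<integral>a. u a \<partial>M) < 0"
  shows "AE a in M. \<exists>C. \<forall>n. birkhoff_sum f u n a \<le> C"
proof -
  interpret prob_space M by fact
  have f: "f \<in> measurable M M" "distr M M f = M"
    using erg by (auto simp: ergodic_system_def)
  have [measurable]: "u \<in> borel_measurable M" "\<And>n. birkhoff_sum f u n \<in> borel_measurable M"
    using u borel_measurable_birkhoff_sum[OF f(1)] by auto
  \<comment> \<open>Thresholds range over \<open>nat\<close> so that measurability is a countable
    matter; \<open>unb\<close> recovers all real thresholds.\<close>
  define B where "B = {a \<in> space M. \<forall>c::nat. \<exists>n. birkhoff_sum f u n a > real c}"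
  have B: "B \<in> sets M"
    unfolding B_def by measurable
  have unb: "a \<in> B \<longleftrightarrow> (\<forall>C. \<exists>n. birkhoff_sum f u n a > C)" if "a \<in> space M" for a
    unfolding B_def using that by (auto, meson le_less_trans real_arch_simple)
  have fB: "f a \<in> B \<longleftrightarrow> a \<in> B" if a: "a \<in> space M" for a
  proof -
    have fa: "f a \<in> space M"
      using measurable_space[OF f(1) a] .
    have "(\<forall>C. \<exists>n. birkhoff_sum f u n (f a) > C) \<longleftrightarrow> (\<forall>C. \<exists>n. birkhoff_sum f u n a > C)"
    proof (intro iffI allI)
      fix C assume "\<forall>C. \<exists>n. birkhoff_sum f u n (f a) > C"
      then obtain n where "birkhoff_sum f u n (f a) > C - u a" by blast
      then show "\<exists>n. birkhoff_sum f u n a > C"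
        by (intro exI[of _ "Suc n"]) (simp add: birkhoff_sum_Suc)
    next
      fix C assume "\<forall>C. \<exists>n. birkhoff_sum f u n a > C"
      \<comment> \<open>A threshold of at least 0 rules out the empty sum, so a first term can be
        split off.\<close>
      then obtain n where n: "birkhoff_sum f u n a > max 0 (C + u a)" by blast
      then have "n \<noteq> 0"
        by (cases n) (auto simp: birkhoff_sum_def)
      then obtain m where "n = Suc m"
        using not0_implies_Suc by blast
      with n show "\<exists>n. birkhoff_sum f u n (f a) > C"
        by (intro exI[of _ m]) (simp add: birkhoff_sum_Suc)
    qed
    then show ?thesis
      using unb[OF a] unb[OF fa] by simp
  qed
  have "f -` B \<inter> space M = B"
    using fB sets.sets_into_space[OF B] by blast
  then have "measure M B = 0 \<or> measure M B = 1"
    using erg B by (auto simp: ergodic_system_def)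
  moreover have "measure M B \<noteq> 1"
  proof
    assume "measure M B = 1"
    then have AEB: "AE a in M. a \<in> B"
      using B prob_eq_1 by blast
    let ?E = "\<lambda>n. {a \<in> space M. 0 < birkhoff_max f u (Suc n) a}"
    have [measurable]: "\<And>n. birkhoff_max f u n \<in> borel_measurable M"
      using integrable_birkhoff_max[OF f u] by blast
    have "(\<lambda>n. \<integral>a. indicator (?E n) a * u a \<partial>M) \<longlonglongrightarrow> (\<integral>a. u a \<partial>M)"
    proof (rule integral_dominated_convergence[where w = "\<lambda>a. norm (u a)"])
      show "AE a in M. (\<lambda>n. indicator (?E n) a * u a) \<longlonglongrightarrow> u a"
      proof (rule AE_mp[OF AEB], rule AE_I2, rule impI)
        fix a assume a: "a \<in> space M" "a \<in> B"
        then obtain m where m: "birkhoff_sum f u m a > 0"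
          using unb by blast
        have "eventually (\<lambda>n. indicator (?E n) a * u a = u a) sequentially"
        proof (rule eventually_sequentiallyI)
          fix n assume "m \<le> n"
          then have "birkhoff_max f u m a \<le> birkhoff_max f u (Suc n) a"
            by (intro birkhoff_max_mono) simp
          then have "0 < birkhoff_max f u (Suc n) a"
            using m birkhoff_sum_le_max[of f u m a] by linarith
          then show "indicator (?E n) a * u a = u a"
            using a by (simp del: birkhoff_max.simps)
        qed
        then show "(\<lambda>n. indicator (?E n) a * u a) \<longlonglongrightarrow> u a"
          by (rule tendsto_eventually)
      qed
      show "integrable M (\<lambda>a. norm (u a))"
        using u by (rule integrable_norm)
      show "AE a in M. norm (indicator (?E n) a * u a) \<le> norm (u a)" for n
        by (rule AE_I2) (simp add: indicator_def)
    qed measurable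
    then have "0 \<le> (\<integral>a. u a \<partial>M)"
      using maximal_ergodic_inequality[OF f u] by (intro LIMSEQ_le_const) auto
    with neg show False by simp
  qed
  ultimately have "AE a in M. a \<notin> B"
    using B prob_eq_0 by blast
  then show ?thesis
  proof (rule AE_mp, intro AE_I2 impI)
    fix a assume "a \<in> space M" "a \<notin> B"
    then show "\<exists>C. \<forall>n. birkhoff_sum f u n a \<le> C"
      using unb by (meson not_less)
  qed
qed

lemma birkhoff_sum_diff: "birkhoff_sum f (\<lambda>a. u a - v a) n a = birkhoff_sum f u n a - birkhoff_sum f v n a"
  by (simp add: birkhoff_sum_def sum_subtractf)

lemma birkhoff_sum_const: "birkhoff_sum f (\<lambda>_. c) n a = real n * c"
  by (simp add: birkhoff_sum_def)

lemma AE_birkhoff_sum_near: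
  assumes "prob_space M" and erg: "ergodic_system M f" and u: "integrable M u"
  shows "AE a in M. \<forall>e>0. \<exists>C. \<forall>n. \<bar>birkhoff_sum f u n a - real n * (\<integral>a. u a \<partial>M)\<bar> \<le> real n * e + C"
proof -
  interpret prob_space M by fact
  let ?I = "\<integral>a. u a \<partial>M"
  have one: "AE a in M. \<exists>C. \<forall>n. \<bar>birkhoff_sum f u n a - real n * ?I\<bar> \<le> real n * e + C"
    if "e > 0" for e
  proof -
    \<comment> \<open>Both shifted functions have integral \<open>- e < 0\<close>, so the one-sided
      bound applies to each.\<close>
    have "AE a in M. \<exists>C. \<forall>n. birkhoff_sum f (\<lambda>a. u a - (?I + e)) n a \<le> C"
      using u that by (intro AE_birkhoff_sum_bounded_above assms) (auto simp: prob_space)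
    moreover have "AE a in M. \<exists>C. \<forall>n. birkhoff_sum f (\<lambda>a. (?I - e) - u a) n a \<le> C"
      using u that by (intro AE_birkhoff_sum_bounded_above assms) (auto simp: prob_space)
    ultimately show ?thesis
    proof eventually_elim
      case (elim a)
      obtain C1 where C1: "\<And>n. birkhoff_sum f u n a - real n * (?I + e) \<le> C1"
        using elim(1) unfolding birkhoff_sum_diff birkhoff_sum_const by blast
      obtain C2 where C2: "\<And>n. real n * ?I - real n * e - birkhoff_sum f u n a \<le> C2"
        using elim(2) unfolding birkhoff_sum_diff birkhoff_sum_const by blast
      have "\<bar>birkhoff_sum f u n a - real n * ?I\<bar> \<le> real n * e + max C1 C2" for n
        using C1[of n] C2[of n] unfolding abs_le_iff distrib_left right_diff_distrib
        by (intro conjI; linarith)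
      then show ?case by blast
    qed
  qed
  \<comment> \<open>Only countably many values of \<open>e\<close> are treated, so that one null set
    serves for all of them.\<close>
  have "AE a in M. \<forall>i. \<exists>C. \<forall>n. \<bar>birkhoff_sum f u n a - real n * ?I\<bar> \<le> real n * (1 / real (Suc i)) + C"
    by (intro AE_all_countable[THEN iffD2] allI one) simp
  then show ?thesis
  proof eventually_elim
    case (elim a)
    show ?case
    proof (intro allI impI)
      fix e :: real assume "e > 0"
      then obtain i where i: "1 / real (Suc i) < e"
        using nat_approx_posE by blast
      obtain C where C: "\<And>n. \<bar>birkhoff_sum f u n a - real n * ?I\<bar> \<le> real n * (1 / real (Suc i)) + C"
        using elim by blast
      have "real n * (1 / real (Suc i)) \<le> real n * e" for n
        using i by (intro mult_left_mono) auto
      then show "\<exists>C. \<forall>n. \<bar>birkhoff_sum f u n a - real n * ?I\<bar> \<le> real n * e + C"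
        by (intro exI[of _ C] allI) (rule order_trans[OF C add_right_mono])
    qed
  qed
qed

section \<open>Exponential growth of the cocycle\<close>

definition cocycle :: "('a \<Rightarrow> 'a) \<Rightarrow> ('a \<Rightarrow> complex) \<Rightarrow> nat \<Rightarrow> 'a \<Rightarrow> complex" where
  "cocycle f h n a = (\<Prod>i<n. h ((f ^^ i) a))"

text \<open>Preimages of null sets are null, and countably many of them may be discarded. This keeps
  \<open>h\<close> nonzero along a whole orbit.\<close>

lemma AE_iterate_measure_preserving:
  assumes f: "f \<in> measurable M M" "distr M M f = M"
    and P: "{a \<in> space M. P a} \<in> sets M" and AE: "AE a in M. P a"
  shows "AE a in M. \<forall>i. P ((f ^^ i) a)"
proof -
  have "AE a in M. P ((f ^^ i) a)" for i
  proof (induction i)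
    case (Suc i)
    have "{a \<in> space M. P ((f ^^ i) a)} = (f ^^ i) -` {a \<in> space M. P a} \<inter> space M"
      using measurable_space[OF measurable_compose_n[OF f(1), of i]] by auto
    then have "{a \<in> space M. P ((f ^^ i) a)} \<in> sets M"
      using measurable_sets[OF measurable_compose_n[OF f(1)] P] by simp
    then have "AE a in M. P ((f ^^ i) (f a))"
      using AE_distr_iff[OF f(1), of "\<lambda>a. P ((f ^^ i) a)"] Suc.IH unfolding f(2) by blast
    then show ?case
      by (simp add: funpow_swap1)
  qed (use AE in simp)
  then show ?thesis
    by (simp add: AE_all_countable)
qed

text \<open>This passes from the extended logarithm to the real one. Since
  \<open>\<infinity> - x = \<infinity>\<close> in \<open>ereal\<close> for every \<open>x\<close>, a
  finite difference forces first \<open>?p\<close> and then \<open>?q\<close> to be finite.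
  Finiteness of \<open>?q\<close> makes the zeros of \<open>h\<close> a null set, off which
  \<open>elog\<close> and \<open>ln\<close> agree.\<close>

lemma elog_ext_integral_finite:
  assumes h: "h \<in> borel_measurable M"
    and fin: "ext_integral M (\<lambda>a. elog (cmod (h a))) = ereal \<gamma>"
  shows "AE a in M. h a \<noteq> 0" "integrable M (\<lambda>a. ln (cmod (h a)))"
    "(\<integral>a. ln (cmod (h a)) \<partial>M) = \<gamma>"
proof -
  note [measurable] = h
  let ?p = "\<integral>\<^sup>+ a. e2ennreal (elog (cmod (h a))) \<partial>M"
  let ?q = "\<integral>\<^sup>+ a. e2ennreal (- elog (cmod (h a))) \<partial>M"
  have pq: "enn2ereal ?p - enn2ereal ?q = ereal \<gamma>"
    using fin by (simp add: ext_integral_def)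
  have p: "?p \<noteq> \<infinity>"
    using pq by auto
  then have p': "enn2ereal ?p \<noteq> \<infinity>"
    by simp
  have "enn2ereal ?q \<noteq> \<infinity>"
    using pq p' by (cases "enn2ereal ?p") auto
  then have q: "?q \<noteq> \<infinity>"
    by auto
  have [measurable]: "(\<lambda>a. elog (cmod (h a))) \<in> borel_measurable M"
    unfolding elog_def by measurable
  have "AE a in M. e2ennreal (- elog (cmod (h a))) \<noteq> \<infinity>"
    using q by (intro nn_integral_PInf_AE) auto
  then show nz: "AE a in M. h a \<noteq> 0"
    by eventually_elim (auto simp: elog_def)
  have pe: "?p = (\<integral>\<^sup>+ a. ennreal (ln (cmod (h a))) \<partial>M)"
    by (rule nn_integral_cong_AE) (use nz in eventually_elim, simp add: elog_def)
  have qe: "?q = (\<integral>\<^sup>+ a. ennreal (- ln (cmod (h a))) \<partial>M)"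
    by (rule nn_integral_cong_AE) (use nz in eventually_elim, simp add: elog_def)
  show int: "integrable M (\<lambda>a. ln (cmod (h a)))"
    using p q unfolding pe qe real_integrable_def by simp
  have "(\<integral>a. ln (cmod (h a)) \<partial>M) = enn2real ?p - enn2real ?q"
    unfolding pe qe by (rule real_lebesgue_integral_def[OF int])
  also have "ereal \<dots> = enn2ereal ?p - enn2ereal ?q"
    using p q by (cases ?p; cases ?q) (auto simp: enn2ereal_ennreal)
  finally show "(\<integral>a. ln (cmod (h a)) \<partial>M) = \<gamma>"
    using pq by simp
qed

text \<open>This encodes that the cocycle never vanishes at \<open>a\<close> and has Lyapunov
  exponent \<open>\<gamma>\<close> there. The constant \<open>C\<close> may depend on
  \<open>a\<close> and \<open>e\<close> but not on the time, so the bounds hold at all times and not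
  just eventually.\<close>

definition lyapunov_regular ::
    "('a \<Rightarrow> 'a) \<Rightarrow> ('a \<Rightarrow> complex) \<Rightarrow> real \<Rightarrow> 'a \<Rightarrow> bool" where
  "lyapunov_regular f h \<gamma> a \<longleftrightarrow> (\<forall>e>0. \<exists>C. \<forall>n.
     exp (real n * (\<gamma> - e) - C) \<le> cmod (cocycle f h n a) \<and>
     cmod (cocycle f h n a) \<le> exp (real n * (\<gamma> + e) + C))"

lemma AE_lyapunov_regular:
  assumes prob: "prob_space M" and erg: "ergodic_system M f" and h: "h \<in> borel_measurable M"
    and fin: "ext_integral M (\<lambda>a. elog (cmod (h a))) = ereal \<gamma>"
  shows "AE a in M. lyapunov_regular f h \<gamma> a"
proof -
  let ?u = "\<lambda>a. ln (cmod (h a))"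
  note [measurable] = h
  note * = elog_ext_integral_finite[OF h fin]
  have f: "f \<in> measurable M M" "distr M M f = M"
    using erg by (auto simp: ergodic_system_def)
  have "AE a in M. \<forall>i. h ((f ^^ i) a) \<noteq> 0"
    by (intro AE_iterate_measure_preserving f *) measurable
  moreover have "AE a in M. \<forall>e>0. \<exists>C. \<forall>n. \<bar>birkhoff_sum f ?u n a - real n * \<gamma>\<bar> \<le> real n * e + C"
    using AE_birkhoff_sum_near[OF prob erg *(2)] *(3) by simp
  ultimately show ?thesis
  proof eventually_elim
    case (elim a)
    \<comment> \<open>Nonvanishing along the orbit matters: a zero of \<open>h\<close> would add
      \<open>ln 0 = 0\<close> to the sum but annihilate the product.\<close>
    have coc: "cmod (cocycle f h n a) = exp (birkhoff_sum f ?u n a)" for n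
      using elim(1) by (simp add: cocycle_def birkhoff_sum_def exp_sum prod_norm)
    show ?case
      unfolding lyapunov_regular_def
    proof (intro allI impI)
      fix e :: real assume "e > 0"
      then obtain C where C: "\<And>n. \<bar>birkhoff_sum f ?u n a - real n * \<gamma>\<bar> \<le> real n * e + C"
        using elim(2) by blast
      show "\<exists>C. \<forall>n. exp (real n * (\<gamma> - e) - C) \<le> cmod (cocycle f h n a) \<and>
          cmod (cocycle f h n a) \<le> exp (real n * (\<gamma> + e) + C)"
      proof (intro exI[of _ C] allI)
        fix n
        show "exp (real n * (\<gamma> - e) - C) \<le> cmod (cocycle f h n a) \<and>
            cmod (cocycle f h n a) \<le> exp (real n * (\<gamma> + e) + C)"
          using C[of n] by (simp add: coc abs_le_iff algebra_simps)
      qed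
    qed
  qed
qed

section \<open>Iterates of the skew product, with analytic and topological tools\<close>

lemma funpow_skew_product:
  assumes T: "\<And>c x. T (c *\<^sub>C x) = c *\<^sub>C T x"
  shows "(skew_product f h T ^^ n) (a, x) = ((f ^^ n) a, cocycle f h n a *\<^sub>C (T ^^ n) x)"
  by (induction n) (simp_all add: skew_product_def cocycle_def scaleC_one T scaleC_scaleC mult.commute)

lemma bounded_linear_scaleC: "bounded_linear (\<lambda>x. c *\<^sub>C (x :: 'x::complex_normed_vector))"
proof (rule bounded_linear_intro[where K = "cmod c"])
  show "c *\<^sub>C (r *\<^sub>R x) = r *\<^sub>R (c *\<^sub>C x)" for r and x :: 'x
    by (simp add: scaleR_scaleC scaleC_scaleC mult.commute)
qed (simp_all add: scaleC_add_right norm_scaleC mult.commute)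

lemma bounded_clinear_scaleC:
  assumes "bounded_clinear T"
  shows "T (c *\<^sub>C x) = c *\<^sub>C T x"
proof -
  interpret T: Vector_Spaces.linear scaleC scaleC T
    using assms by (simp add: bounded_clinear_def)
  show ?thesis
    by (rule T.scale)
qed

lemma bounded_clinear_imp_bounded_linear:
  assumes "bounded_clinear T"
  shows "bounded_linear T"
proof -
  interpret T: Vector_Spaces.linear scaleC scaleC T
    using assms by (simp add: bounded_clinear_def)
  obtain K where "\<And>x. norm (T x) \<le> K * norm x"
    using assms by (auto simp: bounded_clinear_def)
  then show ?thesis
    by (intro bounded_linear_intro[where K = K]) (simp_all add: T.add T.scale scaleR_scaleC mult.commute)
qed

lemma bounded_linear_funpow: "bounded_linear (T :: 'x::real_normed_vector \<Rightarrow> 'x) \<Longrightarrow> bounded_linear (T ^^ n)"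
proof (induction n)
  case (Suc n)
  then show ?case
    using bounded_linear_compose[of T "T ^^ n"] by (simp add: o_def)
qed (simp add: id_def bounded_linear_ident)

text \<open>The strict inequality leaves room for a number \<open>s\<close> below
  \<open>exp \<delta>\<close> that eventually bounds the roots. The resulting gap \<open>e\<close>
  will absorb the subexponential error of the cocycle.\<close>

lemma limsup_root_less_exp:
  fixes b :: "nat \<Rightarrow> real"
  assumes lim: "limsup (\<lambda>k. ereal (root (n k) (b k))) < ereal (exp \<delta>)"
    and n: "\<And>k. n k > 0" and b: "\<And>k. b k \<ge> 0"
  obtains e where "e > 0" "\<forall>\<^sub>F k in sequentially. b k \<le> exp (real (n k) * (\<delta> - e))"
proof -
  obtain r where r: "limsup (\<lambda>k. ereal (root (n k) (b k))) < ereal r" "r < exp \<delta>"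
    using ereal_dense2[OF lim] by auto
  \<comment> \<open>The maximum ensures \<open>s > 0\<close>, so that
    \<open>s = exp (ln s)\<close>.\<close>
  define s where "s = max r (exp (\<delta> - 1))"
  have s: "0 < s" "s < exp \<delta>"
    using r by (auto simp: s_def less_max_iff_disj)
  show thesis
  proof
    show "\<delta> - ln s > 0"
      using s by (simp add: ln_less_cancel_iff[of s "exp \<delta>", simplified])
    show "\<forall>\<^sub>F k in sequentially. b k \<le> exp (real (n k) * (\<delta> - (\<delta> - ln s)))"
      using Limsup_lessD[OF r(1)]
    proof eventually_elim
      case (elim k)
      have "b k = root (n k) (b k) ^ n k"
        using n b by (simp add: real_root_pow_pos2)
      also have "\<dots> \<le> s ^ n k"
        using elim n b by (intro power_mono) (auto simp: s_def real_root_ge_zero)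
      also have "\<dots> = exp (real (n k) * ln s)"
        using s by (simp add: exp_of_nat_mult)
      finally show ?case by simp
    qed
  qed
qed

lemma dense_range_funpow_vimage:
  fixes T :: "'x::topological_space \<Rightarrow> 'x"
  assumes T: "continuous_on UNIV T" and dense: "closure (range T) = UNIV"
    and V: "open V" "V \<noteq> {}"
  shows "(T ^^ j) -` V \<noteq> {}"
  using V
proof (induction j arbitrary: V)
  case (Suc j)
  have "range T \<inter> V \<noteq> {}"
    using Suc.prems dense open_Int_closure_eq_empty[of V "range T"] by auto
  then have "T -` V \<noteq> {}"
    by auto
  moreover have "open (T -` V)"
    using T Suc.prems(1) by (simp add: open_vimage)
  ultimately have "(T ^^ j) -` (T -` V) \<noteq> {}"
    using Suc.IH by blast
  then show ?case
    by auto
qed simp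

text \<open>Minimality makes the preimages of \<open>V\<close> an open cover, and compactness leaves
  finitely many. As \<open>J\<close> does not depend on the point, a pigeonhole argument over the
  times \<open>n k\<close> becomes possible.\<close>

lemma minimal_system_finite_return:
  fixes f :: "'a::topological_space \<Rightarrow> 'a"
  assumes "compact (UNIV :: 'a set)" and f: "continuous_on UNIV f" and min: "minimal_system f"
    and V: "open V" "V \<noteq> {}"
  obtains J where "finite J" "\<forall>a. \<exists>j\<in>J. (f ^^ j) a \<in> V"
proof -
  have "open ((f ^^ j) -` V)" for j
  proof (induction j)
    case (Suc j)
    have "(f ^^ Suc j) -` V = f -` ((f ^^ j) -` V)"
      by (auto simp: funpow_swap1)
    then show ?case
      using open_vimage[OF Suc.IH f] by (simp only:)
  qed (use V in simp)
  moreover have "UNIV \<subseteq> (\<Union>j. (f ^^ j) -` V)"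
  proof
    fix a
    have "orbit f a \<inter> V \<noteq> {}"
      using min V open_Int_closure_eq_empty[of V "orbit f a"] by (auto simp: minimal_system_def)
    then show "a \<in> (\<Union>j. (f ^^ j) -` V)"
      by (auto simp: orbit_def)
  qed
  ultimately obtain J where "finite J" "UNIV \<subseteq> (\<Union>j\<in>J. (f ^^ j) -` V)"
    using compactE_image[OF assms(1), of UNIV "\<lambda>j. (f ^^ j) -` V"] by auto
  then show thesis
    using that by blast
qed

lemma tendsto_zero_exp_bound:
  fixes g :: "nat \<Rightarrow> 'b::real_normed_vector"
  assumes n: "strict_mono n" and e: "e > 0"
    and g: "\<forall>\<^sub>F k in sequentially. norm (g k) \<le> exp (c - real (n k) * e)"
  shows "g \<longlonglongrightarrow> 0"
proof (rule Lim_null_comparison[OF g])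
  have "filterlim (\<lambda>k. real (n k)) at_top sequentially"
    using filterlim_compose[OF filterlim_real_sequentially filterlim_subseq[OF n]] .
  then have "filterlim (\<lambda>k. real (n k) * e) at_top sequentially"
    using e by (rule filterlim_at_top_mult_tendsto_pos[OF tendsto_const, rotated])
  then have "filterlim (\<lambda>k. - c + real (n k) * e) at_top sequentially"
    by (rule filterlim_tendsto_add_at_top[OF tendsto_const])
  then show "(\<lambda>k. exp (c - real (n k) * e)) \<longlonglongrightarrow> 0"
    by (intro filterlim_compose[OF exp_at_bot]) (simp add: filterlim_uminus_at_bot)
qed

text \<open>The union of finite nets of radii \<open>1 / Suc i\<close> is countable and
  dense.\<close>

lemma compact_imp_separable:
  assumes "compact (UNIV :: ('a::metric_space) set)"
  obtains A :: "('a::metric_space) set" where "countable A" "closure A = UNIV"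
proof -
  have "\<exists>F. finite F \<and> (UNIV :: 'a set) \<subseteq> (\<Union>x\<in>F. ball x (1 / Suc i))" for i
    using seq_compact_imp_totally_bounded[OF compact_imp_seq_compact[OF assms]] by auto
  then obtain F where F: "\<And>i. finite (F i)" "\<And>i. (UNIV :: 'a set) \<subseteq> (\<Union>x\<in>F i. ball x (1 / Suc i))"
    by metis
  show thesis
  proof
    show "countable (\<Union>i. F i)"
      using F(1) by (simp add: countable_finite)
    have "b \<in> closure (\<Union>i. F i)" for b
      unfolding closure_approachable
    proof (intro allI impI)
      fix r :: real assume "r > 0"
      then obtain i where i: "1 / Suc i < r"
        using nat_approx_posE by auto
      obtain x where "x \<in> F i" "dist x b < 1 / Suc i"
        using subsetD[OF F(2), of b i] by auto
      with i show "\<exists>x\<in>\<Union>i. F i. dist x b < r"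
        by (intro bexI[of _ x]) auto
    qed
    then show "closure (\<Union>i. F i) = UNIV"
      by auto
  qed
qed

section \<open>Transitivity in a single fibre and in the product\<close>

lemma dense_meets_open:
  assumes "closure D = UNIV" "open U" "U \<noteq> {}"
  obtains x where "x \<in> D" "x \<in> U"
  using open_Int_closure_eq_empty[OF assms(2), of D] assms by auto

text \<open>The measure is left out on purpose: ergodicity enters the lemmas below only through
  \<open>lyapunov_regular\<close>.\<close>

locale hypercyclic_skew_product =
  fixes f :: "'a::metric_space \<Rightarrow> 'a" and h :: "'a \<Rightarrow> complex" and \<gamma> :: real
    and T :: "'x::{complex_normed_vector, banach} \<Rightarrow> 'x"
    and D1 D2 :: "'x set" and n :: "nat \<Rightarrow> nat" and S :: "nat \<Rightarrow> 'x \<Rightarrow> 'x"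
  assumes compact: "compact (UNIV :: 'a set)"
    and f: "continuous_on UNIV f"
    and minimal: "minimal_system f"
    and T: "bounded_clinear T"
    and D1: "closure D1 = UNIV"
    and D2: "closure D2 = UNIV"
    and n: "strict_mono n"
    and n_pos: "\<And>k. n k > 0"
    and T_small: "\<And>x. x \<in> D1 \<Longrightarrow>
      limsup (\<lambda>k. ereal (root (n k) (norm ((T ^^ n k) x)))) < ereal (exp (- \<gamma>))"
    and S_small: "\<And>y. y \<in> D2 \<Longrightarrow>
      limsup (\<lambda>k. ereal (root (n k) (norm (S (n k) y)))) < ereal (exp \<gamma>)"
    and T_S: "\<And>y. y \<in> D2 \<Longrightarrow> (\<lambda>k. norm ((T ^^ n k) (S (n k) y) - y)) \<longlonglongrightarrow> 0"
begin

lemma T_linear: "bounded_linear T"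
  using T by (rule bounded_clinear_imp_bounded_linear)

lemma T_pow_linear: "bounded_linear (T ^^ j)"
  using T_linear by (rule bounded_linear_funpow)

lemma T_pow_scaleC: "(T ^^ j) (c *\<^sub>C x) = c *\<^sub>C (T ^^ j) x"
  by (induction j) (simp_all add: bounded_clinear_scaleC[OF T])

lemma T_S_tendsto: "y \<in> D2 \<Longrightarrow> (\<lambda>k. (T ^^ n k) (S (n k) y)) \<longlonglongrightarrow> y"
  by (rule LIM_zero_cancel, rule tendsto_norm_zero_cancel, rule T_S)

text \<open>Each \<open>y\<close> in \<open>D2\<close> is the limit of the vectors in (iii), which
  lie in the range of \<open>T\<close> because \<open>n k > 0\<close>.\<close>

lemma dense_range: "closure (range T) = UNIV"
proof -
  have "D2 \<subseteq> closure (range T)"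
  proof
    fix y assume "y \<in> D2"
    have "(T ^^ n k) x \<in> range T" for k x
      using n_pos[of k] by (cases "n k") auto
    then show "y \<in> closure (range T)"
      unfolding closure_sequential
      by (intro exI[of _ "\<lambda>k. (T ^^ n k) (S (n k) y)"]) (use T_S_tendsto[OF \<open>y \<in> D2\<close>] in simp)
  qed
  then show ?thesis
    using D2 closure_minimal[of D2 "closure (range T)"] by auto
qed

text \<open>The base point stays fixed and only the fibre vector is chosen, so the result serves
  both transitivity of the product and density in the Baire argument over \<open>a\<close>.\<close>

lemma fibre_transitive:
  assumes a: "lyapunov_regular f h \<gamma> a"
    and V1: "open V1" "V1 \<noteq> {}" and V2: "open V2" "V2 \<noteq> {}" and U: "open U" "U \<noteq> {}"
  obtains x N where "x \<in> U" "N \<ge> 1" "(f ^^ N) a \<in> V1" "cocycle f h N a *\<^sub>C (T ^^ N) x \<in> V2"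
proof -
  obtain J where J: "finite J" "\<forall>b. \<exists>j\<in>J. (f ^^ j) b \<in> V1"
    using minimal_system_finite_return[OF compact f minimal V1] .
  \<comment> \<open>The uniform return is applied at the points \<open>(f ^^ n k) a\<close>; as
    \<open>J\<close> is finite, one delay \<open>j\<close> recurs for infinitely many
    \<open>k\<close>.\<close>
  have "\<exists>\<^sub>F k in sequentially. \<exists>j\<in>J. (f ^^ (j + n k)) a \<in> V1"
    using J(2) by (simp add: funpow_add eventually_frequently)
  from frequently_bex_finite[OF J(1) this]
  obtain j where freq: "\<exists>\<^sub>F k in sequentially. (f ^^ (j + n k)) a \<in> V1"
    by blast
  interpret Tj: bounded_linear "T ^^ j"
    by (rule T_pow_linear)
  interpret T_pow: bounded_linear "T ^^ n k" for k
    by (rule T_pow_linear)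
  obtain x0 where x0: "x0 \<in> D1" "x0 \<in> U"
    using dense_meets_open[OF D1 U] .
  have "open ((T ^^ j) -` V2)" "(T ^^ j) -` V2 \<noteq> {}"
    using open_vimage[OF V2(1) Tj.continuous_on[OF continuous_on_id, unfolded id_def]]
      dense_range_funpow_vimage[OF _ dense_range V2] bounded_linear.continuous_on[OF T_linear continuous_on_id]
    by auto
  then obtain y where y: "y \<in> D2" "(T ^^ j) y \<in> V2"
    using dense_meets_open[OF D2] by (metis vimageE)
  define c where "c k = cocycle f h (j + n k) a" for k
  define z where "z k = inverse (c k) *\<^sub>C S (n k) y" for k
  define w where "w k = c k *\<^sub>C (T ^^ n k) x0" for k
  obtain d where d: "d > 0"
    "\<forall>\<^sub>F k in sequentially. norm ((T ^^ n k) x0) \<le> exp (real (n k) * (- \<gamma> - d))"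
    using limsup_root_less_exp[OF T_small[OF x0(1)] n_pos] by auto
  obtain e where e: "e > 0"
    "\<forall>\<^sub>F k in sequentially. norm (S (n k) y) \<le> exp (real (n k) * (\<gamma> - e))"
    using limsup_root_less_exp[OF S_small[OF y(1)] n_pos] by auto
  \<comment> \<open>Half of each gap is conceded to the cocycle and the other half remains as the
    decay rate of \<open>z\<close> and \<open>w\<close>. The delay \<open>j\<close> affects only the
    constants.\<close>
  obtain B where B: "\<And>m. exp (real m * (\<gamma> - e / 2) - B) \<le> cmod (cocycle f h m a)"
    using a e(1) unfolding lyapunov_regular_def by (metis half_gt_zero)
  obtain C where C: "\<And>m. cmod (cocycle f h m a) \<le> exp (real m * (\<gamma> + d / 2) + C)"
    using a d(1) unfolding lyapunov_regular_def by (metis half_gt_zero)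
  \<comment> \<open>The lower bound excludes zeros, so \<open>z\<close> does not meet the default
    \<open>inverse 0 = 0\<close>.\<close>
  have c_nz: "c k \<noteq> 0" for k
    using less_le_trans[OF exp_gt_zero B] unfolding c_def by (metis norm_zero order_less_irrefl)
  have "w \<longlonglongrightarrow> 0"
  proof (rule tendsto_zero_exp_bound[OF n])
    show "d / 2 > 0" using d by simp
    show "\<forall>\<^sub>F k in sequentially. norm (w k) \<le> exp (real j * (\<gamma> + d / 2) + C - real (n k) * (d / 2))"
      using d(2)
    proof eventually_elim
      case (elim k)
      have "norm (w k) \<le> exp (real (j + n k) * (\<gamma> + d / 2) + C) * exp (real (n k) * (- \<gamma> - d))"
        unfolding w_def norm_scaleC c_def by (intro mult_mono C elim) auto
      also have "\<dots> = exp (real j * (\<gamma> + d / 2) + C - real (n k) * (d / 2))"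
        unfolding exp_add[symmetric] by (simp add: algebra_simps)
      finally show ?case .
    qed
  qed
  moreover have "z \<longlonglongrightarrow> 0"
  proof (rule tendsto_zero_exp_bound[OF n])
    show "e / 2 > 0" using e by simp
    show "\<forall>\<^sub>F k in sequentially. norm (z k) \<le> exp (B - real j * (\<gamma> - e / 2) - real (n k) * (e / 2))"
      using e(2)
    proof eventually_elim
      case (elim k)
      have "norm (z k) = norm (S (n k) y) / cmod (c k)"
        unfolding z_def norm_scaleC by (simp add: norm_inverse divide_inverse mult.commute)
      also have "\<dots> \<le> exp (real (n k) * (\<gamma> - e)) / exp (real (j + n k) * (\<gamma> - e / 2) - B)"
        unfolding c_def by (intro frac_le B elim) auto
      also have "\<dots> = exp (B - real j * (\<gamma> - e / 2) - real (n k) * (e / 2))"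
        unfolding exp_diff[symmetric] by (simp add: algebra_simps)
      finally show ?case .
    qed
  qed
  ultimately have lim: "(\<lambda>k. x0 + z k) \<longlonglongrightarrow> x0"
    "(\<lambda>k. (T ^^ j) (w k + (T ^^ n k) (S (n k) y))) \<longlonglongrightarrow> (T ^^ j) y"
    using tendsto_add[OF tendsto_const, of z 0 sequentially x0]
      Tj.tendsto[OF tendsto_add[OF _ T_S_tendsto[OF y(1)]], of w 0] by simp_all
  \<comment> \<open>Scalars commute with powers of \<open>T\<close>, so \<open>c k\<close> can act
    before the last \<open>j\<close> steps: there it cancels the inverse in \<open>z k\<close> and
    turns the share of \<open>x0\<close> into \<open>w k\<close>.\<close>
  have image: "cocycle f h (j + n k) a *\<^sub>C (T ^^ (j + n k)) (x0 + z k)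
      = (T ^^ j) (w k + (T ^^ n k) (S (n k) y))" for k
  proof -
    have "c k *\<^sub>C (T ^^ n k) (x0 + z k) = w k + (T ^^ n k) (S (n k) y)"
      by (simp add: T_pow.add T_pow_scaleC scaleC_add_right scaleC_scaleC scaleC_one c_nz w_def z_def)
    then show ?thesis
      by (simp add: c_def[symmetric] funpow_add T_pow_scaleC[symmetric])
  qed
  have "\<forall>\<^sub>F k in sequentially. x0 + z k \<in> U"
    using topological_tendstoD[OF lim(1) U(1) x0(2)] .
  moreover have "\<forall>\<^sub>F k in sequentially. (T ^^ j) (w k + (T ^^ n k) (S (n k) y)) \<in> V2"
    using topological_tendstoD[OF lim(2) V2(1) y(2)] .
  ultimately have "\<forall>\<^sub>F k in sequentially. x0 + z k \<in> U \<and>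
      (T ^^ j) (w k + (T ^^ n k) (S (n k) y)) \<in> V2"
    by (rule eventually_conj)
  from frequently_ex[OF frequently_eventually_conj[OF freq this]]
  obtain k where k: "(f ^^ (j + n k)) a \<in> V1" "x0 + z k \<in> U"
      "(T ^^ j) (w k + (T ^^ n k) (S (n k) y)) \<in> V2"
    by auto
  show thesis
    using that[of "x0 + z k" "j + n k"] k n_pos[of k] by (simp add: image)
qed

text \<open>Each \<open>G V1 V2\<close> is open by continuity in the fibre and dense by
  \<open>fibre_transitive\<close>. Countably many pairs of balls suffice, and any vector in the
  intersection of their sets \<open>G\<close> works. Completeness is needed of the fibre
  only.\<close>

lemma ex_transitive_point:
  assumes a: "lyapunov_regular f h \<gamma> a" and sep: "separable_space (euclidean :: 'x topology)"
  shows "\<exists>x. transitive_point (skew_product f h T) (a, x)"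
proof -
  obtain A :: "'a set" where A: "countable A" "closure A = UNIV"
    using compact_imp_separable[OF compact] .
  obtain X :: "'x set" where X: "countable X" "closure X = UNIV"
    using sep by (auto simp: separable_space_def)
  define G where "G V1 V2 = {x. \<exists>N. (f ^^ N) a \<in> V1 \<and> cocycle f h N a *\<^sub>C (T ^^ N) x \<in> V2}"
    for V1 :: "'a set" and V2 :: "'x set"
  have G_open: "open (G V1 V2)" if "open V2" for V1 V2
  proof -
    have "continuous_on UNIV (\<lambda>x. cocycle f h N a *\<^sub>C (T ^^ N) x)" for N
      by (intro bounded_linear.continuous_on[OF bounded_linear_scaleC]
          bounded_linear.continuous_on[OF T_pow_linear] continuous_on_id)
    then have "open ((\<lambda>x. cocycle f h N a *\<^sub>C (T ^^ N) x) -` V2)" for N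
      using that by (intro open_vimage)
    moreover have "G V1 V2 = (\<Union>N\<in>{N. (f ^^ N) a \<in> V1}. (\<lambda>x. cocycle f h N a *\<^sub>C (T ^^ N) x) -` V2)"
      by (auto simp: G_def)
    ultimately show ?thesis
      by auto
  qed
  have G_dense: "closure (G V1 V2) = UNIV" if "open V1" "V1 \<noteq> {}" "open V2" "V2 \<noteq> {}" for V1 V2
  proof -
    have "\<exists>x\<in>U. x \<in> G V1 V2" if U: "open U" "U \<noteq> {}" for U
      using fibre_transitive[OF a \<open>open V1\<close> \<open>V1 \<noteq> {}\<close> \<open>open V2\<close> \<open>V2 \<noteq> {}\<close> U]
      unfolding G_def by blast
    then show ?thesis
      unfolding closure_interior
      by (metis Compl_UNIV_eq ComplD double_complement interior_subset open_interior subsetD)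
  qed
  define \<G> where "\<G> = (\<lambda>(p, q, i, j). G (ball p (1 / Suc i)) (ball q (1 / Suc j))) ` (A \<times> X \<times> UNIV \<times> UNIV)"
  have "euclidean closure_of \<Inter>\<G> = topspace (euclidean :: 'x topology)"
  proof (rule Baire_category)
    show "countable \<G>"
      unfolding \<G>_def using A(1) X(1) by (intro countable_image countable_SIGMA) auto
    show "openin euclidean W \<and> euclidean closure_of W = topspace euclidean" if "W \<in> \<G>" for W
      using that by (auto simp: \<G>_def G_open G_dense)
  qed (simp add: completely_metrizable_space_euclidean)
  then have "\<Inter>\<G> \<noteq> {}"
    by auto
  then obtain x where x: "x \<in> \<Inter>\<G>"
    by blast
  have "(b, y) \<in> closure (orbit (skew_product f h T) (a, x))" for b y
    unfolding closure_approachable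
  proof (intro allI impI)
    fix r :: real assume "r > 0"
    \<comment> \<open>The ball centres are within \<open>r / 4\<close> of both the target and the
      orbit point, so each coordinate errs by less than \<open>r / 2\<close>; the product distance
      is at most the sum of the two.\<close>
    then obtain i where i: "1 / Suc i < r / 4"
      using nat_approx_posE[of "r / 4"] by auto
    have "b \<in> closure A" "y \<in> closure X"
      using A X by auto
    then obtain p q where p: "p \<in> A" "dist p b < 1 / Suc i" and q: "q \<in> X" "dist q y < 1 / Suc i"
      unfolding closure_approachable by (metis of_nat_0_less_iff zero_less_Suc zero_less_divide_1_iff)
    have "x \<in> G (ball p (1 / Suc i)) (ball q (1 / Suc i))"
      using x p q by (force simp: \<G>_def)
    then obtain N where N: "dist p ((f ^^ N) a) < 1 / Suc i"
        "dist q (cocycle f h N a *\<^sub>C (T ^^ N) x) < 1 / Suc i"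
      by (auto simp: G_def)
    have "dist ((f ^^ N) a) b < r / 2"
      using dist_triangle3[of "(f ^^ N) a" b p] p(2) N(1) i by linarith
    moreover have "dist (cocycle f h N a *\<^sub>C (T ^^ N) x) y < r / 2"
      using dist_triangle3[of "cocycle f h N a *\<^sub>C (T ^^ N) x" y q] q(2) N(2) i by linarith
    ultimately have "dist ((skew_product f h T ^^ N) (a, x)) (b, y) < r"
      unfolding funpow_skew_product[of T, OF bounded_clinear_scaleC[OF T]] dist_Pair_Pair
      by (intro le_less_trans[OF sqrt_sum_squares_le_sum]) simp_all
    then show "\<exists>u\<in>orbit (skew_product f h T) (a, x). dist u (b, y) < r"
      unfolding orbit_def by blast
  qed
  then have "closure (orbit (skew_product f h T) (a, x)) = UNIV"
    by (auto simp: set_eq_iff)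
  then show ?thesis
    unfolding transitive_point_def by blast
qed

text \<open>Inside a box contained in \<open>U\<close>, density supplies a regular base point, and
  \<open>fibre_transitive\<close> then picks the vector over it.\<close>

lemma topologically_transitive_skew_product:
  assumes regular_dense: "closure {a. lyapunov_regular f h \<gamma> a} = UNIV"
  shows "topologically_transitive (skew_product f h T)"
  unfolding topologically_transitive_def
proof (intro allI impI, elim conjE)
  fix U V :: "('a \<times> 'x) set"
  assume U: "open U" "U \<noteq> {}" and V: "open V" "V \<noteq> {}"
  have box: "\<exists>W1 W2. open W1 \<and> W1 \<noteq> {} \<and> open W2 \<and> W2 \<noteq> {} \<and> W1 \<times> W2 \<subseteq> W"
    if "open W" "W \<noteq> {}" for W :: "('a \<times> 'x) set"
  proof -
    obtain p where "p \<in> W"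
      using \<open>W \<noteq> {}\<close> by blast
    obtain W1 W2 where "open W1" "open W2" "p \<in> W1 \<times> W2" "W1 \<times> W2 \<subseteq> W"
      using open_prod_elim[OF \<open>open W\<close> \<open>p \<in> W\<close>] .
    then show ?thesis
      by blast
  qed
  obtain U1 U2 where U12: "open U1" "U1 \<noteq> {}" "open U2" "U2 \<noteq> {}" "U1 \<times> U2 \<subseteq> U"
    using box[OF U] by blast
  obtain V1 V2 where V12: "open V1" "V1 \<noteq> {}" "open V2" "V2 \<noteq> {}" "V1 \<times> V2 \<subseteq> V"
    using box[OF V] by blast
  obtain a where a: "lyapunov_regular f h \<gamma> a" "a \<in> U1"
    using dense_meets_open[OF regular_dense U12(1,2)] by auto
  obtain x N where "x \<in> U2" "N \<ge> 1" "(f ^^ N) a \<in> V1" "cocycle f h N a *\<^sub>C (T ^^ N) x \<in> V2"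
    using fibre_transitive[OF a(1) V12(1-4) U12(3,4)] .
  then have "(skew_product f h T ^^ N) (a, x) \<in> V" "(a, x) \<in> U"
    using a(2) U12(5) V12(5) by (auto simp: funpow_skew_product bounded_clinear_scaleC[OF T])
  then show "\<exists>N\<ge>1. (skew_product f h T ^^ N) ` U \<inter> V \<noteq> {}"
    using \<open>N \<ge> 1\<close> by blast
qed

end

section \<open>Passage from almost every base point to density and full measure\<close>

theorem theorem4p4:
  fixes f :: "'a::{metric_space, perfect_space} \<Rightarrow> 'a"
    and \<mu> :: "'a measure"
    and h :: "'a \<Rightarrow> complex"
    and \<gamma> :: real
    and T :: "'x::{complex_normed_vector, banach} \<Rightarrow> 'x"
    and D1 D2 :: "'x set"
    and n :: "nat \<Rightarrow> nat"
    and S :: "nat \<Rightarrow> 'x \<Rightarrow> 'x"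
  assumes "compact (UNIV :: 'a set)"
    and "continuous_on UNIV f"
    and "minimal_system f"
    and "sets \<mu> = sets borel"
    and "prob_space \<mu>"
    and "full_support \<mu>"
    and "ergodic_system \<mu> f"
    and "continuous_on UNIV h"
    and "ext_integral \<mu> (\<lambda>a. elog (cmod (h a))) = ereal \<gamma>"
    and "infinite_dimensional TYPE('x)"
    and "separable_space (euclidean :: 'x topology)"
    and "bounded_clinear T"
    and "closure D1 = UNIV"
    and "closure D2 = UNIV"
    and "strict_mono n"
    and "\<forall>k. n k > 0"
    and "\<forall>x\<in>D1. limsup (\<lambda>k. ereal (root (n k) (norm ((T ^^ n k) x)))) < ereal (exp (- \<gamma>))"
    and "\<forall>y\<in>D2. limsup (\<lambda>k. ereal (root (n k) (norm (S (n k) y)))) < ereal (exp \<gamma>)"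
    and "\<forall>y\<in>D2. (\<lambda>k. norm ((T ^^ n k) (S (n k) y) - y)) \<longlonglongrightarrow> 0"
  shows "topologically_transitive (skew_product f h T) \<and>
         emeasure (completion \<mu>) {a. \<exists>x. transitive_point (skew_product f h T) (a, x)} = 1"
proof -
  interpret prob_space \<mu> by fact
  interpret hypercyclic_skew_product f h \<gamma> T D1 D2 n S
    using assms by unfold_locales auto
  have space: "space \<mu> = UNIV"
    using sets_eq_imp_space_eq[OF \<open>sets \<mu> = sets borel\<close>] by simp
  have "h \<in> borel_measurable \<mu>"
    using borel_measurable_continuous_onI[OF \<open>continuous_on UNIV h\<close>]
      measurable_cong_sets[OF \<open>sets \<mu> = sets borel\<close> refl] by blast
  then have AE: "AE a in \<mu>. lyapunov_regular f h \<gamma> a"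
    using assms by (intro AE_lyapunov_regular)
  \<comment> \<open>The complement of the closure is an open null set, which full support forces to
    be empty.\<close>
  have "closure {a. lyapunov_regular f h \<gamma> a} = UNIV"
  proof (rule ccontr)
    let ?U = "- closure {a. lyapunov_regular f h \<gamma> a}"
    assume "\<not> ?thesis"
    then have "open ?U" "?U \<noteq> {}"
      by (auto simp only: open_Compl closed_closure Compl_empty_eq)
    then have "emeasure \<mu> ?U > 0"
      using \<open>full_support \<mu>\<close> unfolding full_support_def by blast
    moreover have "AE a in \<mu>. a \<notin> ?U"
      using AE by eventually_elim (use closure_subset[of "{a. lyapunov_regular f h \<gamma> a}"] in auto)
    then have "emeasure \<mu> ?U = 0"
      using AE_iff_null_sets[of ?U \<mu>] \<open>sets \<mu> = sets borel\<close> by (auto simp: null_sets_def)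
    ultimately show False
      by simp
  qed
  then have "topologically_transitive (skew_product f h T)"
    by (rule topologically_transitive_skew_product)
  moreover have "emeasure (completion \<mu>) {a. \<exists>x. transitive_point (skew_product f h T) (a, x)} = 1"
    (is "emeasure _ ?E = 1")
  proof -
    have AE_E: "AE a in \<mu>. a \<in> ?E"
      using AE by eventually_elim (use ex_transitive_point assms in auto)
    then obtain N where N: "{a \<in> space \<mu>. a \<notin> ?E} \<subseteq> N" "N \<in> null_sets \<mu>"
      unfolding eventually_ae_filter by blast
    \<comment> \<open>\<open>?E\<close> is a projection and is not shown to be Borel; a null set
      containing its complement is enough for measurability in the completion.\<close>
    have "- ?E \<subseteq> N"
      using N(1) space by blast
    then have "- ?E \<in> null_sets (completion \<mu>)"
      by (rule null_sets_completion_subset) (rule null_sets_completionI[OF N(2)])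
    then have "- ?E \<in> sets (completion \<mu>)"
      by (rule null_setsD2)
    then have "space (completion \<mu>) - - ?E \<in> sets (completion \<mu>)"
      by (rule sets.compl_sets)
    then have E: "?E \<in> sets (completion \<mu>)"
      by (simp only: space space_completion Compl_eq_Diff_UNIV[symmetric] double_complement)
    interpret c: prob_space "completion \<mu>"
      by (rule prob_space_completion)
    show ?thesis
      using c.emeasure_eq_1_AE[OF E AE_completion[OF AE_E]] .
  qed
  ultimately show ?thesis ..
qed

end
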